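(* Let $\alpha,\beta\in\mathbb{Q}$ be such that $p(x)=x^2+\alpha x+\beta$ is irreducible over $\mathbb{Q}$ and its companion matrix $A=\begin{bmatrix}0&-\beta\\1&-\alpha\end{bmatrix}$ is expanding. Let $c$ be the unique positive integer for which $cp(x)=cx^2+ax+b$ has coprime integer coefficients, $a=c\alpha$, $b=c\beta$, let $\mathcal{D}=\{(0,0)^\top,(1,0)^\top,\dots,(|b|-1,0)^\top\}$, and let $\mathcal{A}_\Phi$ be the attractor of the dynamical system $\Phi$ induced by $(A,\mathcal{D})$. Then: (1) If $\alpha>1$ and $\beta-1\le\alpha\le\beta$, then $\mathcal{A}_\Phi=\{0\}$. (2) If $0<\alpha\le1$ and $0<\beta-1<\alpha<\beta$, then $\mathcal{A}_\Phi=\{0\}$ provided that one of the following holds: (a) $\alpha+\beta>2$ and $\beta>2\alpha$; (b) $\alpha+2<2\beta$ and $\beta\le2\alpha$.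
   Context: $\mathbb{Z}^2[A]=\bigcup_{k\ge0}(\mathbb{Z}^2+A\mathbb{Z}^2+\cdots+A^k\mathbb{Z}^2)$. The set $\mathcal{D}$ is a complete residue system of $\mathbb{Z}^2[A]/A\mathbb{Z}^2[A]$. The digit function $\mathrm{d}$ sends $x\in\mathbb{Z}^2[A]$ to the unique $\mathrm{d}(x)\in\mathcal{D}$ with $x-\mathrm{d}(x)\in A\mathbb{Z}^2[A]$, and $\Phi(x)=A^{-1}(x-\mathrm{d}(x))$. The attractor $\mathcal{A}_\Phi$ is the smallest subset $\mathcal{S}\subseteq\mathbb{Z}^2[A]$ such that $\Phi(\mathcal{S})\subseteq\mathcal{S}$ and for every $x\in\mathbb{Z}^2[A]$ there is $k\in\mathbb{N}$ with $\Phi^k(x)\in\mathcal{S}$. *)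

theory Defs
  imports "HOL-Analysis.Analysis" "HOL-Computational_Algebra.Computational_Algebra"
begin

definition companion :: "rat \<Rightarrow> rat \<Rightarrow> rat ^ 2 ^ 2" where
  "companion \<alpha> \<beta> = vector [vector [0, - \<beta>], vector [1, - \<alpha>]]"

definition expanding :: "rat ^ 2 ^ 2 \<Rightarrow> bool" where
  "expanding A \<longleftrightarrow>
     (\<forall>(z::complex) (v::complex ^ 2).
        v \<noteq> 0 \<and> map_matrix of_rat A *v v = z *s v \<longrightarrow> norm z > 1)"

definition int_vecs :: "(rat ^ 2) set" where
  "int_vecs = {v. \<forall>i. v $ i \<in> \<int>}"

text \<open>The module $\mathbb{Z}^2[A]$. Matrix powers are written as iterated application,
  since \<open>A ^ i\<close> and \<open>A * B\<close> on the vector type would be componentwise.\<close>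

definition int_vecs_adjoin :: "rat ^ 2 ^ 2 \<Rightarrow> (rat ^ 2) set" where
  "int_vecs_adjoin A =
     (\<Union>k::nat. {(\<Sum>i\<le>k. (((*v) A) ^^ i) (w i)) | w. \<forall>i\<le>k. w i \<in> int_vecs})"

definition digit_set :: "int \<Rightarrow> (rat ^ 2) set" where
  "digit_set b = {vector [of_int j, 0] | j. 0 \<le> j \<and> j < \<bar>b\<bar>}"

text \<open>The digit function and the map are meaningful for \<open>x \<in> int_vecs_adjoin A\<close>
  and \<open>D\<close> a complete residue system modulo \<open>A\<close>.\<close>

definition digit :: "rat ^ 2 ^ 2 \<Rightarrow> (rat ^ 2) set \<Rightarrow> rat ^ 2 \<Rightarrow> rat ^ 2" where
  "digit A D x = (THE d. d \<in> D \<and> x - d \<in> ((*v) A) ` int_vecs_adjoin A)"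

definition digit_map :: "rat ^ 2 ^ 2 \<Rightarrow> (rat ^ 2) set \<Rightarrow> rat ^ 2 \<Rightarrow> rat ^ 2" where
  "digit_map A D x = matrix_inv A *v (x - digit A D x)"

definition attracting :: "rat ^ 2 ^ 2 \<Rightarrow> (rat ^ 2) set \<Rightarrow> (rat ^ 2) set \<Rightarrow> bool" where
  "attracting A D S \<longleftrightarrow>
     S \<subseteq> int_vecs_adjoin A \<and>
     digit_map A D ` S \<subseteq> S \<and>
     (\<forall>x\<in>int_vecs_adjoin A. \<exists>k. (digit_map A D ^^ k) x \<in> S)"

text \<open>\<open>is_attractor A D S\<close>: the smallest attracting set exists and equals \<open>S\<close>.\<close>

definition is_attractor :: "rat ^ 2 ^ 2 \<Rightarrow> (rat ^ 2) set \<Rightarrow> (rat ^ 2) set \<Rightarrow> bool" where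
  "is_attractor A D S \<longleftrightarrow> attracting A D S \<and> (\<forall>T. attracting A D T \<longrightarrow> S \<subseteq> T)"

lemma is_attractor_unique: "is_attractor A D S \<Longrightarrow> is_attractor A D T \<Longrightarrow> S = T"
  unfolding is_attractor_def by blast

end

theory Submission
  imports Defs
begin

text \<open>The module $\mathbb{Z}^2[A]$ is cyclic, generated by the first unit vector, so its elements
  are images of integer polynomials; by Gauss's lemma the kernel is generated by $cX^2 + aX + b$.
  Hence $\Phi$ lifts to $q \mapsto (q - q_0)/X - \lfloor q_0/b \rfloor (cX + a)$. After finitely many
  steps the orbit of any $q$ lies in the lattice spanned by $c$ and $cX + a$, on which the lift is
  the shift radix system $(m,n) \mapsto (n, -\lfloor (cm + an)/b \rfloor)$. In each parameter region,
  an explicit finite symmetric set of witnesses, closed under this map, shows by Brunotte's criterion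
  that all orbits of the shift radix system end in $0$.\<close>

section \<open>Shift radix systems and Brunotte's criterion\<close>

text \<open>Shift radix system with parameters $(c/b, a/b)$, in integer arithmetic.\<close>

definition srs :: "int \<Rightarrow> int \<Rightarrow> int \<Rightarrow> int \<times> int \<Rightarrow> int \<times> int" where
  "srs a b c z = (snd z, - ((c * fst z + a * snd z) div b))"

definition srs_finite :: "int \<Rightarrow> int \<Rightarrow> int \<Rightarrow> int \<times> int \<Rightarrow> bool" where
  "srs_finite a b c z \<longleftrightarrow> (\<exists>k. (srs a b c ^^ k) z = 0)"

lemma srs_0: "srs a b c 0 = 0"
  by (simp add: srs_def zero_prod_def)

lemma srs_finite_0: "srs_finite a b c 0"
  unfolding srs_finite_def by (rule exI[of _ 0]) simp

lemma srs_finite_if_iterate: "srs_finite a b c ((srs a b c ^^ k) z) \<Longrightarrow> srs_finite a b c z"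
  unfolding srs_finite_def by (metis comp_apply funpow_add)

lemma srs_finite_step: "srs a b c z = w \<Longrightarrow> srs_finite a b c w \<Longrightarrow> srs_finite a b c z"
  using srs_finite_if_iterate[of a b c 1] by simp

text \<open>The new entry is the unique integer \<open>l\<close> that brings
  \<open>c * m + a * n + b * l\<close> into the interval from 0 to \<open>b - 1\<close>. In this
  form each entry of the orbit tables below amounts to two linear inequalities.\<close>

lemma srs_eqI:
  assumes "0 \<le> c * m + a * n + b * l" "c * m + a * n + b * l < b"
  shows "srs a b c (m, n) = (n, l)"
proof -
  have "(c * m + a * n) div b = - l"
    using assms by (intro int_div_pos_eq[where r = "c * m + a * n + b * l"]) auto
  then show ?thesis by (simp add: srs_def)
qed

text \<open>The floor of a sum is the sum of the floors or one more. The second case forces the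
  residue of the second summand to be nonzero, so its floor plus one is its ceiling, and the ceiling
  of x is minus the floor of -x.\<close>

lemma srs_add:
  assumes "b > 0"
  shows "srs a b c (z + w) \<in> {srs a b c z + srs a b c w, srs a b c z - srs a b c (- w)}"
proof -
  define s where "s = c * fst z + a * snd z"
  define t where "t = c * fst w + a * snd w"
  have st: "c * fst (z + w) + a * snd (z + w) = s + t"
    and mt: "c * fst (- w) + a * snd (- w) = - t"
    by (simp_all add: s_def t_def algebra_simps)
  have split: "(s + t) div b = s div b + t div b + (s mod b + t mod b) div b"
    by (rule div_add1_eq)
  have bounds: "0 \<le> s mod b" "s mod b < b" "0 \<le> t mod b" "t mod b < b"
    using assms by simp_all
  show ?thesis
  proof (cases "s mod b + t mod b < b")
    case True
    then have "(s + t) div b = s div b + t div b"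
      using split bounds by simp
    then have "srs a b c (z + w) = srs a b c z + srs a b c w"
      unfolding srs_def st by (simp add: s_def[symmetric] t_def[symmetric] prod_eq_iff)
    then show ?thesis by simp
  next
    case False
    then have "(s mod b + t mod b) div b = 1"
      using False bounds by (intro int_div_pos_eq[where r = "s mod b + t mod b - b"]; linarith)
    moreover have "t mod b \<noteq> 0"
      using False bounds by linarith
    then have "(- t) div b = - (t div b) - 1"
      using assms by (simp add: zdiv_zminus1_eq_if)
    ultimately have "(s + t) div b = s div b - (- t) div b"
      using split by simp
    then have "srs a b c (z + w) = srs a b c z - srs a b c (- w)"
      unfolding srs_def st mt by (simp add: s_def[symmetric] prod_eq_iff)
    then show ?thesis by simp
  qed
qed

text \<open>A perturbation \<open>v\<close> is replaced in each step by \<open>srs a b c v\<close>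
  or by \<open>- srs a b c (- v)\<close>. Closure and symmetry keep both in
  \<open>V\<close>.\<close>

lemma srs_iterate_add:
  assumes "b > 0"
    and closed: "\<And>v. v \<in> V \<Longrightarrow> srs a b c v \<in> V"
    and symm: "\<And>v. v \<in> V \<Longrightarrow> - v \<in> V"
    and "w \<in> V"
  shows "\<exists>v\<in>V. (srs a b c ^^ k) (z + w) = (srs a b c ^^ k) z + v"
proof (induction k)
  case 0
  then show ?case using \<open>w \<in> V\<close> by auto
next
  case (Suc k)
  then obtain v where v: "v \<in> V" "(srs a b c ^^ k) (z + w) = (srs a b c ^^ k) z + v"
    by blast
  have "srs a b c v \<in> V" "- srs a b c (- v) \<in> V"
    using v(1) by (simp_all add: closed symm)
  moreover have "(srs a b c ^^ Suc k) (z + w) = srs a b c ((srs a b c ^^ k) z + v)"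
    using v(2) by simp
  ultimately show ?case
    using srs_add[OF \<open>b > 0\<close>, of a c "(srs a b c ^^ k) z" v] by fastforce
qed

text \<open>Brunotte's criterion: if the orbit of $z$ reaches $0$, then by the previous lemma the orbit of
  $z + w$ enters $V$, so one can add unit vectors one at a time.\<close>

lemma srs_finite_if_witnesses:
  assumes "b > 0"
    and closed: "\<And>v. v \<in> V \<Longrightarrow> srs a b c v \<in> V"
    and symm: "\<And>v. v \<in> V \<Longrightarrow> - v \<in> V"
    and unit: "(1, 0) \<in> V" "(0, 1) \<in> V"
    and finite: "\<And>v. v \<in> V \<Longrightarrow> srs_finite a b c v"
  shows "srs_finite a b c z"
proof -
  have add: "srs_finite a b c (z + w)" if "srs_finite a b c z" "w \<in> V" for z w
  proof -
    obtain k where "(srs a b c ^^ k) z = 0"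
      using \<open>srs_finite a b c z\<close> by (auto simp: srs_finite_def)
    moreover have "\<exists>v\<in>V. (srs a b c ^^ k) (z + w) = (srs a b c ^^ k) z + v"
      by (rule srs_iterate_add[OF \<open>b > 0\<close> closed symm \<open>w \<in> V\<close>])
    ultimately obtain v where "v \<in> V" "(srs a b c ^^ k) (z + w) = v"
      by (metis add_0)
    then show ?thesis
      using finite[OF \<open>v \<in> V\<close>] srs_finite_if_iterate[of a b c k "z + w"] by metis
  qed
  have sub: "srs_finite a b c (z - w)" if "srs_finite a b c z" "w \<in> V" for z w
    using add[OF that(1) symm[OF that(2)]] by (metis diff_conv_add_uminus)
  have fst: "srs_finite a b c (m, 0)" for m
  proof (induction m rule: int_induct[where k = 0])
    case base
    show ?case using srs_finite_0[of a b c] by (simp add: zero_prod_def)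
  next
    case (step1 i)
    then show ?case using add[of "(i, 0)", OF _ unit(1)] by simp
  next
    case (step2 i)
    then show ?case using sub[of "(i, 0)", OF _ unit(1)] by simp
  qed
  have "srs_finite a b c (m, n)" for m n
  proof (induction n rule: int_induct[where k = 0])
    case base
    show ?case by (rule fst)
  next
    case (step1 i)
    then show ?case using add[of "(m, i)", OF _ unit(2)] by simp
  next
    case (step2 i)
    then show ?case using sub[of "(m, i)", OF _ unit(2)] by simp
  qed
  then show ?thesis by (cases z) auto
qed

section \<open>Finiteness in the three parameter regions\<close>

text \<open>Monotone coefficients, as in Kovacs's theorem on canonical number systems. Here
  \<open>V\<close> is what the two unit vectors generate under the map and negation.\<close>

lemma srs_finite_monotone:
  assumes "0 < c" "c \<le> a" "a \<le> b" "c < b"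
  shows "srs_finite a b c z"
proof -
  let ?f = "srs a b c"
  define V :: "(int \<times> int) set" where
    "V = {0, (1, 0), (0, 1), (1, -1), (-1, 0), (0, -1), (-1, 1)}"
  have f: "?f (1, 0) = (0, 0)" "?f (-1, 0) = (0, 1)" "?f (0, -1) = (-1, 1)"
      "?f (-1, 1) = (1, 0)"
    using assms by - (rule srs_eqI; linarith)+
  have f': "?f (0, 1) = (1, 0) \<or> ?f (0, 1) = (1, -1)"
    using assms by (cases "a < b") (auto intro!: srs_eqI)
  have f'': "?f (1, -1) = (-1, 0) \<or> ?f (1, -1) = (-1, 1)"
    using assms by (cases "a = c") (auto intro!: srs_eqI)
  show ?thesis
  proof (rule srs_finite_if_witnesses)
    show "b > 0" using assms by simp
    show "?f v \<in> V" if "v \<in> V" for v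
      using that f f' f'' srs_0[of a b c] unfolding V_def by (elim insertE) (auto simp: zero_prod_def)
    show "- v \<in> V" if "v \<in> V" for v
      using that by (auto simp: V_def)
    show "(1, 0) \<in> V" "(0, 1) \<in> V" by (auto simp: V_def)
    have r10: "srs_finite a b c (1, 0)"
      using srs_finite_step[OF f(1)] srs_finite_0[of a b c] by (simp add: zero_prod_def)
    have rm: "srs_finite a b c (-1, 1)" using srs_finite_step[OF f(4) r10] .
    have r0m: "srs_finite a b c (0, -1)" using srs_finite_step[OF f(3) rm] .
    \<comment> \<open>The boundary cases \<open>a = b\<close> and \<open>a = c\<close> together
      would give the cycle (0,1), (1,-1), (-1,0), (0,1). Since \<open>c < b\<close>, at most one of
      them occurs, and either way the chain escapes to (1,0) or (-1,1).\<close>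
    have "srs_finite a b c (0, 1) \<and> srs_finite a b c (1, -1) \<and> srs_finite a b c (-1, 0)"
    proof (cases "a = b")
      case True
      then have "?f (1, -1) = (-1, 1)"
        using assms by (intro srs_eqI) auto
      then show ?thesis
        using srs_finite_step f(2) f' r10 rm by blast
    next
      case False
      then have "?f (0, 1) = (1, 0)"
        using assms by (intro srs_eqI) auto
      then show ?thesis
        using srs_finite_step f(2) f'' r10 rm by blast
    qed
    then show "srs_finite a b c v" if "v \<in> V" for v
      using that r10 rm r0m srs_finite_0 by (auto simp: V_def)
  qed
qed

text \<open>The inequality \<open>2 * c < a + b\<close> sends (2,-1) to (-1,0) and (-2,1) to (1,1),
  and \<open>2 * a < b\<close> sends (0,2) to (2,0) and (0,-2) to (-2,1). This keeps everything
  generated by the unit vectors within entries of absolute value at most 2.\<close>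

lemma srs_finite_small_middle:
  assumes "0 < a" "a < c" "c < b" "b < c + a" "2 * c < a + b" "2 * a < b"
  shows "srs_finite a b c z"
proof -
  let ?f = "srs a b c"
  define V :: "(int \<times> int) set" where
    "V = {0, (1, 0), (0, 1), (1, -1), (1, 1), (1, -2), (2, 1), (2, 0), (0, 2), (2, -1),
      (-1, 0), (0, -1), (-1, 1), (-1, -1), (-1, 2), (-2, -1), (-2, 0), (0, -2), (-2, 1)}"
  \<comment> \<open>The entries follow a tree rooted at 0: each image is 0, an earlier vector, or
    (-1,2), whose possible images (2,0) and (2,1) come before the entries that lead to it.\<close>
  have f: "?f (1, 0) = (0, 0)" "?f (0, 1) = (1, 0)" "?f (-1, 0) = (0, 1)" "?f (1, -1) = (-1, 0)"
      "?f (1, 1) = (1, -1)" "?f (-1, 1) = (1, 1)" "?f (0, -1) = (-1, 1)" "?f (2, 0) = (0, -1)"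
      "?f (2, 1) = (1, -1)" "?f (-1, -1) = (-1, 2)" "?f (-2, -1) = (-1, 2)" "?f (0, 2) = (2, 0)"
      "?f (-2, 0) = (0, 2)" "?f (2, -1) = (-1, 0)" "?f (-2, 1) = (1, 1)" "?f (0, -2) = (-2, 1)"
    using assms by - (rule srs_eqI; linarith)+
  have f': "?f (-1, 2) = (2, 0) \<or> ?f (-1, 2) = (2, 1)"
    using assms by (cases "c \<le> 2 * a") (auto intro!: srs_eqI)
  have f'': "?f (1, -2) = (-2, 0) \<or> ?f (1, -2) = (-2, 1)"
    using assms by (cases "2 * a \<le> c") (auto intro!: srs_eqI)
  show ?thesis
  proof (rule srs_finite_if_witnesses)
    show "b > 0" using assms by simp
    show "?f v \<in> V" if "v \<in> V" for v
      using that f f' f'' srs_0[of a b c] unfolding V_def by (elim insertE) (auto simp: zero_prod_def)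
    show "- v \<in> V" if "v \<in> V" for v
      using that by (auto simp: V_def)
    show "(1, 0) \<in> V" "(0, 1) \<in> V" by (auto simp: V_def)
    have r: "srs_finite a b c (0, 0)"
      using srs_finite_0[of a b c] by (simp add: zero_prod_def)
    note step = srs_finite_step
    note r1 = step[OF f(1) r]
    note r2 = step[OF f(2) r1]
    note r3 = step[OF f(3) r2]
    note r4 = step[OF f(4) r3]
    note r5 = step[OF f(5) r4]
    note r6 = step[OF f(6) r5]
    note r7 = step[OF f(7) r6]
    note r8 = step[OF f(8) r7]
    note r9 = step[OF f(9) r4]
    have r10: "srs_finite a b c (-1, 2)" using f' step r8 r9 by blast
    note r11 = step[OF f(10) r10] step[OF f(11) r10]
    note r12 = step[OF f(12) r8]
    note r13 = step[OF f(13) r12]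
    note r14 = step[OF f(14) r3]
    note r15 = step[OF f(15) r5]
    note r16 = step[OF f(16) r15]
    have r17: "srs_finite a b c (1, -2)" using f'' step r13 r15 by blast
    show "srs_finite a b c v" if "v \<in> V" for v
      using that r r1 r2 r3 r4 r5 r6 r7 r8 r9 r10 r11 r12 r13 r14 r15 r16 r17 unfolding V_def
      by (elim insertE) (simp_all add: zero_prod_def)
  qed
qed

text \<open>Now \<open>b <= 2 * a\<close> sends (0,2) to (2,-1), and
  \<open>a + 2 * c < 2 * b\<close> sends (2,1) to (1,-1) and (-2,-1) to (-1,2). The vectors (2,-2)
  and (-2,2) join \<open>V\<close> because (0,-2) may go to (-2,2).\<close>

lemma srs_finite_large_middle:
  assumes "0 < a" "a < c" "c < b" "b < c + a" "a + 2 * c < 2 * b" "b \<le> 2 * a"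
  shows "srs_finite a b c z"
proof -
  let ?f = "srs a b c"
  define V :: "(int \<times> int) set" where
    "V = {0, (1, 0), (0, 1), (1, -1), (1, 1), (1, -2), (2, 1), (2, 0), (0, 2), (2, -1), (2, -2),
      (-1, 0), (0, -1), (-1, 1), (-1, -1), (-1, 2), (-2, -1), (-2, 0), (0, -2), (-2, 1), (-2, 2)}"
  have f: "?f (1, 0) = (0, 0)" "?f (0, 1) = (1, 0)" "?f (-1, 0) = (0, 1)" "?f (1, -1) = (-1, 0)"
      "?f (1, 1) = (1, -1)" "?f (-1, 1) = (1, 1)" "?f (0, -1) = (-1, 1)"
      "?f (2, 0) = (0, -1)" "?f (-1, 2) = (2, 0)" "?f (-1, -1) = (-1, 2)" "?f (-2, -1) = (-1, 2)"
      "?f (2, 1) = (1, -1)" "?f (-2, 2) = (2, 1)" "?f (-2, 1) = (1, 1)" "?f (2, -1) = (-1, 0)"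
      "?f (0, 2) = (2, -1)" "?f (-2, 0) = (0, 2)" "?f (2, -2) = (-2, 0)" "?f (1, -2) = (-2, 1)"
    using assms by - (rule srs_eqI; linarith)+
  \<comment> \<open>If \<open>2 * a = b\<close>, the value at (0,-2) is exactly \<open>- b\<close>
    and the quotient is -1; beyond this boundary it drops to -2.\<close>
  have f': "?f (0, -2) = (-2, 1) \<or> ?f (0, -2) = (-2, 2)"
    using assms by (cases "2 * a = b") (auto intro!: srs_eqI)
  show ?thesis
  proof (rule srs_finite_if_witnesses)
    show "b > 0" using assms by simp
    show "?f v \<in> V" if "v \<in> V" for v
      using that f f' srs_0[of a b c] unfolding V_def by (elim insertE) (auto simp: zero_prod_def)
    show "- v \<in> V" if "v \<in> V" for v
      using that by (auto simp: V_def)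
    show "(1, 0) \<in> V" "(0, 1) \<in> V" by (auto simp: V_def)
    have r: "srs_finite a b c (0, 0)"
      using srs_finite_0[of a b c] by (simp add: zero_prod_def)
    note step = srs_finite_step
    note r1 = step[OF f(1) r]
    note r2 = step[OF f(2) r1]
    note r3 = step[OF f(3) r2]
    note r4 = step[OF f(4) r3]
    note r5 = step[OF f(5) r4]
    note r6 = step[OF f(6) r5]
    note r7 = step[OF f(7) r6]
    note r8 = step[OF f(8) r7]
    note r9 = step[OF f(9) r8]
    note r10 = step[OF f(10) r9] step[OF f(11) r9]
    note r12 = step[OF f(12) r4]
    note r13 = step[OF f(13) r12]
    note r14 = step[OF f(14) r5]
    note r15 = step[OF f(15) r3]
    note r16 = step[OF f(16) r15]
    note r17 = step[OF f(17) r16]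
    note r18 = step[OF f(18) r17]
    note r19 = step[OF f(19) r14]
    have r20: "srs_finite a b c (0, -2)"
      using f' step r13 r14 by blast
    show "srs_finite a b c v" if "v \<in> V" for v
      using that r r1 r2 r3 r4 r5 r6 r7 r8 r9 r10 r12 r13 r14 r15 r16 r17 r18 r19 r20
      unfolding V_def by (elim insertE) (simp_all add: zero_prod_def)
  qed
qed

section \<open>The module as an image of the integer polynomials\<close>

text \<open>Horner evaluation of q(A) applied to the first unit vector.\<close>

definition poly_vec :: "rat ^ 2 ^ 2 \<Rightarrow> int poly \<Rightarrow> rat ^ 2" where
  "poly_vec A q = fold_coeffs (\<lambda>j v. vector [of_int j, 0] + A *v v) q 0"

lemma vector_0 [simp]: "vector [0, 0] = (0 :: rat ^ 2)"
  by (simp add: vec_eq_iff forall_2)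

lemma poly_vec_0 [simp]: "poly_vec A 0 = 0"
  by (simp add: poly_vec_def)

lemma poly_vec_pCons [simp]:
  "poly_vec A (pCons j q) = vector [of_int j, 0] + A *v poly_vec A q"
  by (cases "q = 0 \<and> j = 0") (auto simp: poly_vec_def)

lemma poly_vec_add: "poly_vec A (p + q) = poly_vec A p + poly_vec A q"
proof (induction p q rule: poly_induct2)
  case (pCons i p j q)
  have "vector [of_int (i + j), 0] = (vector [of_int i, 0] + vector [of_int j, 0] :: rat ^ 2)"
    by (simp add: vec_eq_iff forall_2)
  with pCons show ?case
    by (simp add: matrix_vector_right_distrib del: of_int_add)
qed simp

lemma poly_vec_minus: "poly_vec A (- q) = - poly_vec A q"
  using poly_vec_add[of A q "- q"] by (simp add: eq_neg_iff_add_eq_0 add.commute)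

lemma poly_vec_diff: "poly_vec A (p - q) = poly_vec A p - poly_vec A q"
  using poly_vec_add[of A p "- q"] by (simp add: poly_vec_minus)

lemma poly_vec_smult: "poly_vec A (smult k q) = of_int k *s poly_vec A q"
proof (induction q)
  case (pCons j q)
  have "vector [of_int (k * j), 0] = (of_int k *s vector [of_int j, 0] :: rat ^ 2)"
    by (simp add: vec_eq_iff forall_2)
  with pCons show ?case
    by (simp add: vector_add_ldistrib vector_scalar_commute del: of_int_mult)
qed simp

lemma poly_vec_monom_mult: "poly_vec A (monom 1 i * q) = (((*v) A) ^^ i) (poly_vec A q)"
proof (induction i)
  case (Suc i)
  have "monom 1 (Suc i) * q = pCons 0 (monom 1 i * q)"
    by (simp add: monom_Suc)
  with Suc show ?case by simp
qed (simp add: monom_0 one_pCons[symmetric])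

text \<open>The kernel is an ideal, because multiplication by X becomes the action of
  \<open>A\<close>.\<close>

lemma poly_vec_mult_eq_0: "poly_vec A p = 0 \<Longrightarrow> poly_vec A (p * q) = 0"
  by (induction q) (simp_all add: poly_vec_add poly_vec_smult)

lemma poly_vec_sum: "poly_vec A (\<Sum>i\<in>I. f i) = (\<Sum>i\<in>I. poly_vec A (f i))"
  by (induction I rule: infinite_finite_induct) (simp_all add: poly_vec_add)

lemma companion_mult:
  "companion \<alpha> \<beta> *v v = vector [- \<beta> * v $ 2, v $ 1 - \<alpha> * v $ 2]"
  by (simp add: vec_eq_iff forall_2 companion_def matrix_vector_mult_def sum_2)

lemma matrix_inv_companion:
  assumes "\<beta> \<noteq> 0"
  shows "matrix_inv (companion \<alpha> \<beta>) *v (companion \<alpha> \<beta> *v v) = v"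
proof -
  let ?A = "companion \<alpha> \<beta>"
  \<comment> \<open>\<open>matrix_inv\<close> is defined by choice, so a two-sided inverse has to be
    exhibited before anything is known about it.\<close>
  let ?B = "vector [vector [- \<alpha> / \<beta>, 1], vector [- 1 / \<beta>, 0]] :: rat ^ 2 ^ 2"
  have "?A ** ?B = mat 1 \<and> ?B ** ?A = mat 1"
    using assms
    by (simp add: vec_eq_iff forall_2 companion_def matrix_matrix_mult_def sum_2 mat_def)
  then have "matrix_inv ?A ** ?A = mat 1"
    unfolding matrix_inv_def by (rule someI2) simp
  then show ?thesis
    by (simp add: matrix_vector_mul_assoc)
qed

text \<open>The companion matrix maps the first unit vector to the second, so an integer vector
  (s,t) is the image of s + tX, and applying \<open>A\<close> i times multiplies by the i-th power
  of X. Conversely, each Horner step raises the existing summands by one power and adds a new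
  summand at index 0.\<close>

lemma int_vecs_adjoin_eq: "int_vecs_adjoin (companion \<alpha> \<beta>) = range (poly_vec (companion \<alpha> \<beta>))"
proof (intro equalityI subsetI)
  let ?A = "companion \<alpha> \<beta>"
  fix x assume "x \<in> int_vecs_adjoin ?A"
  then obtain k w where x: "x = (\<Sum>i\<le>k. (((*v) ?A) ^^ i) (w i))" and w: "\<forall>i\<le>k. w i \<in> int_vecs"
    by (auto simp: int_vecs_adjoin_def)
  have "\<exists>q. w i = poly_vec ?A q" if "i \<le> k" for i
  proof -
    have "w i $ 1 \<in> \<int>" "w i $ 2 \<in> \<int>"
      using w that by (auto simp: int_vecs_def)
    then obtain s t where "w i $ 1 = of_int s" "w i $ 2 = of_int t"
      by (auto elim!: Ints_cases)
    then have "w i = poly_vec ?A [:s, t:]"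
      by (simp add: vec_eq_iff forall_2 companion_mult)
    then show ?thesis ..
  qed
  then obtain q where q: "\<And>i. i \<le> k \<Longrightarrow> w i = poly_vec ?A (q i)"
    by metis
  have "x = poly_vec ?A (\<Sum>i\<le>k. monom 1 i * q i)"
    unfolding x poly_vec_sum poly_vec_monom_mult by (intro sum.cong) (simp_all add: q)
  then show "x \<in> range (poly_vec ?A)" by simp
next
  let ?A = "companion \<alpha> \<beta>"
  fix x assume "x \<in> range (poly_vec ?A)"
  then obtain q where x: "x = poly_vec ?A q" ..
  have "\<exists>k w. poly_vec ?A q = (\<Sum>i\<le>k. (((*v) ?A) ^^ i) (w i)) \<and> (\<forall>i\<le>k. w i \<in> int_vecs)"
  proof (induction q)
    case 0
    have "(0 :: rat ^ 2) \<in> int_vecs" by (simp add: int_vecs_def)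
    then show ?case by (intro exI[of _ 0] exI[of _ "\<lambda>_. 0"]) simp
  next
    case (pCons j q)
    then obtain k w where kw: "poly_vec ?A q = (\<Sum>i\<le>k. (((*v) ?A) ^^ i) (w i))"
        "\<forall>i\<le>k. w i \<in> int_vecs"
      by blast
    define w' where "w' = case_nat (vector [of_int j, 0]) w"
    have "poly_vec ?A (pCons j q) = (\<Sum>i\<le>Suc k. (((*v) ?A) ^^ i) (w' i))"
      unfolding sum.atMost_Suc_shift by (simp add: w'_def kw(1) vec.linear_sum[OF matrix_vector_mul_linear_gen])
    moreover have "w' i \<in> int_vecs" if "i \<le> Suc k" for i
      using that kw(2) by (cases i) (auto simp: w'_def int_vecs_def forall_2)
    ultimately show ?case by blast
  qed
  then show "x \<in> int_vecs_adjoin ?A"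
    unfolding x int_vecs_adjoin_def by blast
qed

section \<open>The lifted map on polynomials\<close>

text \<open>Lifts \<open>digit_map\<close> to polynomials by means of the relation $b = -A(a + cA)$.\<close>

definition poly_step :: "int \<Rightarrow> int \<Rightarrow> int \<Rightarrow> int poly \<Rightarrow> int poly" where
  "poly_step a b c q = poly_shift 1 q - smult (coeff q 0 div b) [:a, c:]"

lemma poly_step_pCons: "poly_step a b c (pCons j q) = q - smult (j div b) [:a, c:]"
proof -
  have "poly_shift 1 (pCons j q) = q"
    by (rule poly_eqI) (simp add: coeff_poly_shift)
  then show ?thesis by (simp add: poly_step_def)
qed

text \<open>Coordinates with respect to the Brunotte basis $c$, $cX + a$.\<close>

definition lattice_poly :: "int \<Rightarrow> int \<Rightarrow> int \<times> int \<Rightarrow> int poly" where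
  "lattice_poly a c z = [:c * fst z + a * snd z, c * snd z:]"

text \<open>With l the quotient of the constant term by \<open>b\<close>, one step leaves cn - l(cX
  + a), whose coordinates are (n, -l).\<close>

lemma poly_step_lattice_poly:
  "poly_step a b c (lattice_poly a c z) = lattice_poly a c (srs a b c z)"
  by (simp add: lattice_poly_def srs_def poly_step_pCons algebra_simps)

text \<open>Each step strips one coefficient from \<open>q\<close> and moves the carry into the
  lattice part. The induction therefore needs an arbitrary lattice summand, although only
  \<open>z = 0\<close> is wanted later.\<close>

lemma poly_step_reaches_lattice:
  "\<exists>k w. (poly_step a b c ^^ k) (q + lattice_poly a c z) = lattice_poly a c w"
proof (induction q arbitrary: z)
  case 0
  show ?case by (rule exI[of _ 0], rule exI[of _ z]) simp
next
  case (pCons j q)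
  define l where "l = (j + (c * fst z + a * snd z)) div b"
  have "poly_step a b c (pCons j q + lattice_poly a c z) = q + lattice_poly a c (snd z, - l)"
    by (simp add: lattice_poly_def poly_step_pCons l_def)
  moreover obtain k w where
    "(poly_step a b c ^^ k) (q + lattice_poly a c (snd z, - l)) = lattice_poly a c w"
    using pCons.IH by blast
  ultimately have "(poly_step a b c ^^ Suc k) (pCons j q + lattice_poly a c z) = lattice_poly a c w"
    by (simp add: funpow_swap1)
  then show ?case by blast
qed

lemma poly_step_reaches_0:
  assumes "\<And>z. srs_finite a b c z"
  shows "\<exists>k. (poly_step a b c ^^ k) q = 0"
proof -
  have zero: "lattice_poly a c 0 = 0"
    by (simp add: lattice_poly_def)
  obtain k w where kw: "(poly_step a b c ^^ k) (q + lattice_poly a c 0) = lattice_poly a c w"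
    using poly_step_reaches_lattice by blast
  obtain l where l: "(srs a b c ^^ l) w = 0"
    using assms unfolding srs_finite_def by blast
  have iter: "(poly_step a b c ^^ l) (lattice_poly a c w) = lattice_poly a c ((srs a b c ^^ l) w)" for l
    by (induction l) (simp_all add: poly_step_lattice_poly)
  have "(poly_step a b c ^^ (l + k)) q = 0"
    using kw l zero iter by (simp add: funpow_add)
  then show ?thesis ..
qed

section \<open>Digits and the attractor for the companion matrix\<close>

locale companion_digits =
  fixes \<alpha> \<beta> :: rat and a b c :: int
  assumes c_pos: "c > 0" and b_pos: "b > 0"
    and a_eq: "of_int a = of_int c * \<alpha>" and b_eq: "of_int b = of_int c * \<beta>"
    and primitive: "Gcd {c, a, b} = 1"
begin

abbreviation A :: "rat ^ 2 ^ 2" where "A \<equiv> companion \<alpha> \<beta>"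

lemma beta_nonzero: "\<beta> \<noteq> 0"
  using b_pos b_eq by auto

text \<open>Cayley-Hamilton: the polynomial is \<open>c\<close> times the characteristic
  polynomial.\<close>

lemma poly_vec_primitive_poly: "poly_vec A [:b, a, c:] = 0"
  by (simp add: vec_eq_iff forall_2 companion_mult a_eq b_eq algebra_simps)

lemma content_primitive_poly: "content [:b, a, c:] = 1"
  using c_pos primitive by (simp add: content_def ac_simps)

text \<open>Gauss's lemma turns divisibility over the rationals, obtained by pseudo-division,
  into divisibility over the integers.\<close>

lemma poly_vec_eq_0_imp_dvd:
  assumes "poly_vec A q = 0"
  shows "[:b, a, c:] dvd q"
proof -
  let ?P = "[:b, a, c:]"
  have P: "?P \<noteq> 0" "degree ?P = 2" using c_pos by simp_all
  obtain k f where k: "k \<noteq> 0" and kf: "smult k q = ?P * f + pseudo_mod q ?P"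
    using pseudo_mod(1)[OF P(1), of q] by blast
  define r where "r = pseudo_mod q ?P"
  have "poly_vec A r = poly_vec A (smult k q - ?P * f)"
    using kf by (simp add: r_def)
  also have "\<dots> = 0"
    by (simp add: poly_vec_diff poly_vec_smult assms poly_vec_mult_eq_0[OF poly_vec_primitive_poly]
        del: mult_pCons_left)
  finally have r0: "poly_vec A r = 0" .
  have "degree r \<le> 1"
    using pseudo_mod(2)[OF P(1), of q] P(2) unfolding r_def by fastforce
  then obtain s t where "r = [:s, t:]"
    by (metis degree1_coeffs One_nat_def degree_0_id pCons_0_0 le_Suc_eq less_one le_zero_eq)
  \<comment> \<open>The image of s + tX is the vector (s,t), so no nonzero polynomial of degree at
    most 1 lies in the kernel.\<close>
  with r0 have "r = 0"
    by (simp add: vec_eq_iff forall_2 companion_mult)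
  then have kf': "smult k q = ?P * f"
    using kf by (simp add: r_def)
  \<comment> \<open>Content is multiplicative and that of \<open>?P\<close> is 1, so
    \<open>k\<close> divides the content of \<open>f\<close> and can be cancelled.\<close>
  have "content f = content (?P * f)"
    by (simp add: content_mult content_primitive_poly del: mult_pCons_left)
  also have "\<dots> = normalize k * content q"
    unfolding kf'[symmetric] by simp
  finally have "k dvd content f" by simp
  then obtain g where "f = smult k g"
    unfolding const_poly_dvd_iff_dvd_content[symmetric] by (auto elim: dvdE)
  with kf' have "smult k q = smult k (?P * g)"
    by (simp only: mult_smult_right)
  then have "smult k (q - ?P * g) = 0"
    by (simp only: smult_diff_right diff_self)
  then have "q = ?P * g"
    using k by (simp only: smult_eq_0_iff right_minus_eq simp_thms)
  then show ?thesis by (simp only: dvd_triv_left)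
qed

text \<open>Once the digit is removed, the constant term is \<open>b * (j div b)\<close>.
  Subtracting \<open>j div b\<close> times the kernel polynomial clears it, and what remains is X
  times \<open>poly_step\<close>.\<close>

lemma poly_vec_minus_digit:
  "poly_vec A (pCons j q) - vector [of_int (j mod b), 0] = A *v poly_vec A (poly_step a b c (pCons j q))"
proof -
  have "poly_vec A (pCons j q) - vector [of_int (j mod b), 0]
      = poly_vec A (pCons j q - [:j mod b:] - smult (j div b) [:b, a, c:])"
    unfolding poly_vec_diff poly_vec_smult poly_vec_primitive_poly by simp
  also have "pCons j q - [:j mod b:] - smult (j div b) [:b, a, c:] = pCons 0 (poly_step a b c (pCons j q))"
    by (simp add: poly_step_pCons minus_mult_div_eq_mod[symmetric])
  finally show ?thesis by simp
qed

text \<open>Existence is the previous lemma. For uniqueness, every kernel polynomial has a constant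
  term divisible by \<open>b\<close>, so a competing digit is congruent to \<open>j\<close> modulo
  \<open>b\<close>.\<close>

lemma digit_poly_vec_pCons:
  "digit A (digit_set b) (poly_vec A (pCons j q)) = vector [of_int (j mod b), 0]"
  unfolding digit_def
proof (rule the_equality, intro conjI)
  show "poly_vec A (pCons j q) - vector [of_int (j mod b), 0] \<in> (*v) A ` int_vecs_adjoin A"
    unfolding int_vecs_adjoin_eq poly_vec_minus_digit by blast
  show "vector [of_int (j mod b), 0] \<in> digit_set b"
    using b_pos by (auto simp: digit_set_def)
  fix d assume d: "d \<in> digit_set b \<and> poly_vec A (pCons j q) - d \<in> (*v) A ` int_vecs_adjoin A"
  then obtain i where i: "d = vector [of_int i, 0]" "0 \<le> i" "i < b"
    using b_pos by (auto simp: digit_set_def)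
  obtain p where "poly_vec A (pCons j q) - d = A *v poly_vec A p"
    using d by (auto simp: int_vecs_adjoin_eq)
  then have "poly_vec A (pCons j q - [:i:] - pCons 0 p) = 0"
    by (simp only: poly_vec_diff) (simp add: i)
  then have "[:b, a, c:] dvd pCons j q - [:i:] - pCons 0 p"
    by (rule poly_vec_eq_0_imp_dvd)
  then obtain g where g: "pCons j q - [:i:] - pCons 0 p = [:b, a, c:] * g" ..
  have "j - i = b * coeff g 0"
    using arg_cong[OF g, of "\<lambda>f. coeff f 0"] by (simp add: coeff_mult)
  then have "j mod b = i mod b"
    by (simp add: mod_eq_dvd_iff)
  then show "d = vector [of_int (j mod b), 0]"
    using i by simp
qed

lemma digit_map_poly_vec:
  "digit_map A (digit_set b) (poly_vec A q) = poly_vec A (poly_step a b c q)"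
proof (cases q)
  case (pCons j p)
  show ?thesis
    unfolding pCons digit_map_def digit_poly_vec_pCons poly_vec_minus_digit
    by (rule matrix_inv_companion[OF beta_nonzero])
qed

lemma is_attractor_zero:
  assumes "\<And>z. srs_finite a b c z"
  shows "is_attractor A (digit_set b) {0}"
proof -
  let ?f = "digit_map A (digit_set b)"
  have iter: "(?f ^^ k) (poly_vec A q) = poly_vec A ((poly_step a b c ^^ k) q)" for k q
    by (induction k) (simp_all add: digit_map_poly_vec)
  have f0: "?f 0 = 0"
    using digit_map_poly_vec[of 0] by (simp add: poly_step_def)
  have f0_iter: "(?f ^^ k) 0 = 0" for k
    by (induction k) (simp_all add: f0)
  have zero: "0 \<in> int_vecs_adjoin A"
    unfolding int_vecs_adjoin_eq by (rule range_eqI[of _ _ 0]) simp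
  have "\<exists>k. (?f ^^ k) x = 0" if x: "x \<in> int_vecs_adjoin A" for x
  proof -
    obtain q where q: "x = poly_vec A q"
      using x by (auto simp: int_vecs_adjoin_eq)
    obtain k where "(poly_step a b c ^^ k) q = 0"
      using poly_step_reaches_0[OF assms] by blast
    then have "(?f ^^ k) x = 0"
      unfolding q iter by simp
    then show ?thesis ..
  qed
  then have "attracting A (digit_set b) {0}"
    using zero f0 by (simp add: attracting_def)
  \<comment> \<open>An attracting set meets the orbit of 0, which consists of 0 alone.\<close>
  moreover have "{0} \<subseteq> T" if "attracting A (digit_set b) T" for T
    using that zero f0_iter unfolding attracting_def by (metis empty_subsetI insert_subset)
  ultimately show ?thesis
    unfolding is_attractor_def by blast
qed

end

section \<open>From the rational parameters to integer inequalities\<close>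

theorem theorem9p3:
  fixes \<alpha> \<beta> :: rat and a b c :: int
  assumes "irreducible [:\<beta>, \<alpha>, 1:]"
    and "expanding (companion \<alpha> \<beta>)"
    and "c > 0"
    and "of_int a = of_int c * \<alpha>"
    and "of_int b = of_int c * \<beta>"
    and "Gcd {c, a, b} = 1"
  shows "(\<alpha> > 1 \<and> \<beta> - 1 \<le> \<alpha> \<and> \<alpha> \<le> \<beta> \<longrightarrow>
            is_attractor (companion \<alpha> \<beta>) (digit_set b) {0}) \<and>
         (0 < \<alpha> \<and> \<alpha> \<le> 1 \<and> 0 < \<beta> - 1 \<and> \<beta> - 1 < \<alpha> \<and> \<alpha> < \<beta> \<and>
            ((\<alpha> + \<beta> > 2 \<and> \<beta> > 2 * \<alpha>) \<or> (\<alpha> + 2 < 2 * \<beta> \<and> \<beta> \<le> 2 * \<alpha>)) \<longrightarrow>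
            is_attractor (companion \<alpha> \<beta>) (digit_set b) {0})"
proof -
  have attr: "is_attractor (companion \<alpha> \<beta>) (digit_set b) {0}"
    if "\<beta> > 0" "\<And>z. srs_finite a b c z"
  proof -
    have "of_int b > (0 :: rat)" using that(1) assms(3,5) by simp
    then interpret companion_digits \<alpha> \<beta> a b c
      using assms by unfold_locales auto
    show ?thesis using that(2) by (rule is_attractor_zero)
  qed
  \<comment> \<open>Multiplying by \<open>c > 0\<close> turns inequalities between 1, \<alpha> and
    \<beta> into inequalities between \<open>c\<close>, \<open>a\<close> and
    \<open>b\<close>.\<close>
  have less: "i < j" if "s < t" "of_int i = of_int c * s" "of_int j = of_int c * t"
    for i j :: int and s t :: rat
  proof -
    have "(of_int i :: rat) < of_int j"
      unfolding that using that(1) assms(3) by (intro mult_strict_left_mono) auto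
    then show ?thesis by simp
  qed
  have le: "i \<le> j" if "s \<le> t" "of_int i = of_int c * s" "of_int j = of_int c * t"
    for i j :: int and s t :: rat
    using less[of s t i j] that by (cases "s = t") simp_all
  note simps = assms(4,5) distrib_left
  show ?thesis
  proof (intro conjI impI; elim conjE)
    assume *: "\<alpha> > 1" "\<beta> - 1 \<le> \<alpha>" "\<alpha> \<le> \<beta>"
    show "is_attractor (companion \<alpha> \<beta>) (digit_set b) {0}"
    proof (rule attr)
      show "\<beta> > 0" using * by simp
      have "c < a" by (rule less[OF *(1)]) (simp_all add: simps)
      moreover have "a \<le> b" by (rule le[OF *(3)]) (simp_all add: simps)
      ultimately show "srs_finite a b c z" for z
        using assms(3) by (intro srs_finite_monotone) auto
    qed
  next
    assume *: "0 < \<alpha>" "\<alpha> \<le> 1" "0 < \<beta> - 1" "\<beta> - 1 < \<alpha>" "\<alpha> < \<beta>"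
      and **: "(\<alpha> + \<beta> > 2 \<and> \<beta> > 2 * \<alpha>) \<or> (\<alpha> + 2 < 2 * \<beta> \<and> \<beta> \<le> 2 * \<alpha>)"
    have "0 < a" by (rule less[OF *(1)]) (simp_all add: simps)
    moreover have "a \<le> c" by (rule le[OF *(2)]) (simp_all add: simps)
    moreover have "c < b" by (rule less[of 1 \<beta>]) (use * in \<open>simp_all add: simps\<close>)
    moreover have "b < c + a" by (rule less[of \<beta> "1 + \<alpha>"]) (use * in \<open>simp_all add: simps\<close>)
    moreover have "(2 * c < a + b \<and> 2 * a < b) \<or> (a + 2 * c < 2 * b \<and> b \<le> 2 * a)"
      using **
    proof (elim disjE conjE)
      assume "\<alpha> + \<beta> > 2" "\<beta> > 2 * \<alpha>"
      then have "2 * c < a + b" "2 * a < b"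
        by - (rule less[of 2 "\<alpha> + \<beta>"] less[of "2 * \<alpha>" \<beta>]; simp add: simps)+
      then show ?thesis by simp
    next
      assume "\<alpha> + 2 < 2 * \<beta>" "\<beta> \<le> 2 * \<alpha>"
      then have "a + 2 * c < 2 * b" "b \<le> 2 * a"
        by - (rule less[of "\<alpha> + 2" "2 * \<beta>"] le[of \<beta> "2 * \<alpha>"]; simp add: simps)+
      then show ?thesis by simp
    qed
    \<comment> \<open>Both middle regions require \<open>a < c\<close>. The boundary
      \<open>a = c\<close>, that is \<alpha> = 1, falls under the monotone case.\<close>
    ultimately have "srs_finite a b c z" for z
      using srs_finite_monotone[of c a b z] srs_finite_small_middle[of a c b z]
        srs_finite_large_middle[of a c b z] assms(3)
      by linarith
    then show "is_attractor (companion \<alpha> \<beta>) (digit_set b) {0}"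
      using * by (intro attr) auto
  qed
qed

end
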